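(* Let $0<\underline{u}<\overline{u}$ and $\mathcal{U}=\{\mathbf{u}\in\mathbb{R}^P:\underline{u}\mathbf{1}\le\mathbf{u}\le\overline{u}\mathbf{1}\}$. The energy function $$E(\boldsymbol{\rho})=\sum_{n\in\mathcal{P}}\left(c_ne^{\rho_n}-2k_ne^{\rho_n/2}+p_n^o\rho_n\right)-\sum_{n\in\mathcal{P}}\sum_{m\in\mathcal{P}}g_{nm}e^{(\rho_n+\rho_m)/2}$$ is convex at any power flow solution in $\mathcal{U}$ if $$[p_n^o]_+\le\underline{\lambda}(\mathbf{G})\,\underline{u}\qquad\text{for all } n\in\mathcal{P},$$ where $[p_n^o]_+=\max\{p_n^o,0\}$.
   Context: DC network model. A DC power system is a connected undirected graph on the finite bus set $\mathcal{N}^+=\{0,1,\dots,N\}$, which is partitioned into the constant-voltage buses $\mathcal{V}$ (with $0\in\mathcal{V}$) and the remaining buses $\mathcal{P}=\mathcal{N}^+\setminus\mathcal{V}$, with $P=|\mathcal{P}|\ge 1$. Line conductances are $g_{nm}=g_{mn}\ge 0$, with $g_{nm}>0$ iff $n,m$ are joined by a line, and $g_{nn}=0$. Voltages $v_m>0$ are given for $m\in\mathcal{V}$. For each $n\in\mathcal{P}$ the load/generator data are: constant-current component $i_n^o\ge0$, constant-conductance component $g_n^o\ge 0$, and constant-power component $p_n^o\in\mathbb{R}$ (positive for loads, negative for generators). For $n\in\mathcal{P}$ define $$c_n=\sum_{m\in\mathcal{N}^+}g_{nm}+g_n^o,\qquad k_n=\sum_{m\in\mathcal{V}}g_{nm}v_m-i_n^o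 .$$ Vectors in $\mathbb{R}^P$ are indexed by $\mathcal{P}$; $\mathbf{1}$ is the all-ones vector; vector inequalities are entrywise. $\mathbf{G}$ is the symmetric $P\times P$ matrix with $G_{nn}=c_n$ and $G_{nm}=-g_{nm}$ for $n\ne m$; $\underline{\lambda}(\mathbf{A})$ is the minimum eigenvalue of a symmetric matrix $\mathbf{A}$. The variable $\boldsymbol{\rho}=(\rho_n)_{n\in\mathcal{P}}\in\mathbb{R}^P$ is related to the squared voltages $\mathbf{u}$ by $\rho_n=\log u_n$. A power flow solution is a $\boldsymbol{\rho}$ satisfying $$c_ne^{\rho_n}-\sum_{m\in\mathcal{P}}g_{nm}e^{(\rho_n+\rho_m)/2}-k_ne^{\rho_n/2}+p_n^o=0\quad\text{for all } n\in\mathcal{P},$$ and it lies in $\mathcal{U}$ if $(e^{\rho_n})_{n\in\mathcal{P}}\in\mathcal{U}$. "$E$ is convex at $\boldsymbol{\rho}$" means that the Hessian of $E$ at $\boldsymbol{\rho}$ is positive semidefinite. *)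

theory Defs
  imports "HOL-Analysis.Analysis"
begin

section \<open>Symmetric matrices and Hessians\<close>

definition eigenvalue :: "real^'n^'n \<Rightarrow> real \<Rightarrow> bool" where
  "eigenvalue A \<mu> \<longleftrightarrow> (\<exists>x. x \<noteq> 0 \<and> A *v x = \<mu> *\<^sub>R x)"

text \<open>Intended for symmetric \<open>A\<close>, whose set of real eigenvalues is finite and nonempty.\<close>

definition min_eigenvalue :: "real^'n^'n \<Rightarrow> real" where
  "min_eigenvalue A = Min {\<mu>. eigenvalue A \<mu>}"

definition positive_semidefinite :: "real^'n^'n \<Rightarrow> bool" where
  "positive_semidefinite A \<longleftrightarrow> transpose A = A \<and> (\<forall>x. 0 \<le> x \<bullet> (A *v x))"

text \<open>\<open>H\<close> is the Jacobian at \<open>x\<close> of the gradient field of \<open>f\<close>, which has to exist in a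
  neighbourhood of \<open>x\<close>; such an \<open>H\<close> is unique.\<close>

definition has_hessian :: "(real^'n \<Rightarrow> real) \<Rightarrow> real^'n^'n \<Rightarrow> real^'n \<Rightarrow> bool" where
  "has_hessian f H x \<longleftrightarrow>
     (\<exists>grad. (\<forall>\<^sub>F y in nhds x. GDERIV f y :> grad y) \<and> (grad has_derivative (\<lambda>h. H *v h)) (at x))"

definition convex_at :: "(real^'n \<Rightarrow> real) \<Rightarrow> real^'n \<Rightarrow> bool" where
  "convex_at f x \<longleftrightarrow> (\<exists>H. has_hessian f H x \<and> positive_semidefinite H)"


section \<open>DC networks\<close>

text \<open>Bus and line data are functions on bus numbers; their values at numbers to which they do not
  apply (outside the bus set, voltages at \<open>\<P>\<close>, load data at \<open>\<V>\<close>) are irrelevant.\<close>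

record dc_network =
  last_bus :: nat                               \<comment> \<open>\<open>N\<close>\<close>
  voltage_buses :: "nat set"                    \<comment> \<open>\<open>\<V>\<close>\<close>
  conductance :: "nat \<Rightarrow> nat \<Rightarrow> real"           \<comment> \<open>\<open>g\<^sub>n\<^sub>m\<close>\<close>
  voltage :: "nat \<Rightarrow> real"                      \<comment> \<open>\<open>v\<^sub>m\<close>, \<open>m \<in> \<V>\<close>\<close>
  load_current :: "nat \<Rightarrow> real"                 \<comment> \<open>\<open>i\<^sub>n\<^sup>o\<close>, \<open>n \<in> \<P>\<close>\<close>
  load_conductance :: "nat \<Rightarrow> real"             \<comment> \<open>\<open>g\<^sub>n\<^sup>o\<close>, \<open>n \<in> \<P>\<close>\<close>
  load_power :: "nat \<Rightarrow> real"                   \<comment> \<open>\<open>p\<^sub>n\<^sup>o\<close>, \<open>n \<in> \<P>\<close>\<close>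

definition buses :: "dc_network \<Rightarrow> nat set" where
  "buses D = {0..last_bus D}"

definition power_buses :: "dc_network \<Rightarrow> nat set" where
  "power_buses D = buses D - voltage_buses D"

definition lines :: "dc_network \<Rightarrow> (nat \<times> nat) set" where
  "lines D = {(n, m). n \<in> buses D \<and> m \<in> buses D \<and> conductance D n m > 0}"

definition valid_dc_network :: "dc_network \<Rightarrow> bool" where
  "valid_dc_network D \<longleftrightarrow>
     voltage_buses D \<subseteq> buses D \<and> 0 \<in> voltage_buses D \<and> card (power_buses D) \<ge> 1 \<and>
     (\<forall>n\<in>buses D. \<forall>m\<in>buses D. conductance D n m = conductance D m n \<and> conductance D n m \<ge> 0) \<and>
     (\<forall>n\<in>buses D. conductance D n n = 0) \<and>
     (\<forall>n\<in>buses D. \<forall>m\<in>buses D. (n, m) \<in> (lines D)\<^sup>*) \<and>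
     (\<forall>m\<in>voltage_buses D. voltage D m > 0) \<and>
     (\<forall>n\<in>power_buses D. load_current D n \<ge> 0 \<and> load_conductance D n \<ge> 0)"

definition c_coeff :: "dc_network \<Rightarrow> nat \<Rightarrow> real" where
  "c_coeff D n = (\<Sum>m\<in>buses D. conductance D n m) + load_conductance D n"

definition k_coeff :: "dc_network \<Rightarrow> nat \<Rightarrow> real" where
  "k_coeff D n = (\<Sum>m\<in>voltage_buses D. conductance D n m * voltage D m) - load_current D n"

text \<open>\<open>\<real>\<^sup>P\<close> is \<open>real^'p\<close>, where \<open>bus :: 'p \<Rightarrow> nat\<close> is an enumeration of \<open>\<P>\<close>, i.e. a bijection
  from the index type onto \<^term>\<open>power_buses D\<close>. Hence a sum over \<open>\<P>\<close> becomes a sum over all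
  indices.\<close>

definition enumerates_power_buses :: "dc_network \<Rightarrow> ('p::finite \<Rightarrow> nat) \<Rightarrow> bool" where
  "enumerates_power_buses D bus \<longleftrightarrow> bij_betw bus UNIV (power_buses D)"

definition G_matrix :: "dc_network \<Rightarrow> ('p::finite \<Rightarrow> nat) \<Rightarrow> real^'p^'p" where
  "G_matrix D bus =
     (\<chi> n m. if n = m then c_coeff D (bus n) else - conductance D (bus n) (bus m))"

definition power_flow_solution :: "dc_network \<Rightarrow> ('p::finite \<Rightarrow> nat) \<Rightarrow> real^'p \<Rightarrow> bool" where
  "power_flow_solution D bus \<rho> \<longleftrightarrow>
     (\<forall>n. c_coeff D (bus n) * exp (\<rho> $ n)
          - (\<Sum>m\<in>UNIV. conductance D (bus n) (bus m) * exp ((\<rho> $ n + \<rho> $ m) / 2))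
          - k_coeff D (bus n) * exp (\<rho> $ n / 2) + load_power D (bus n) = 0)"

definition energy :: "dc_network \<Rightarrow> ('p::finite \<Rightarrow> nat) \<Rightarrow> real^'p \<Rightarrow> real" where
  "energy D bus \<rho> =
     (\<Sum>n\<in>UNIV. c_coeff D (bus n) * exp (\<rho> $ n) - 2 * k_coeff D (bus n) * exp (\<rho> $ n / 2)
                + load_power D (bus n) * \<rho> $ n)
     - (\<Sum>n\<in>UNIV. \<Sum>m\<in>UNIV. conductance D (bus n) (bus m) * exp ((\<rho> $ n + \<rho> $ m) / 2))"

text \<open>In the box, \<open>1\<close> is the all-ones vector and \<open>\<le>\<close> is entrywise.\<close>

definition voltage_box :: "real \<Rightarrow> real \<Rightarrow> (real^'p) set" where
  "voltage_box lo hi = {u. lo *\<^sub>R 1 \<le> u \<and> u \<le> hi *\<^sub>R 1}"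

definition squared_voltages :: "real^'p \<Rightarrow> real^'p" where
  "squared_voltages \<rho> = (\<chi> n. exp (\<rho> $ n))"

end

theory Submission
  imports Defs
begin

text \<open>With \<open>w\<^sub>n = e\<^bsup>\<rho>\<^sub>n/2\<^esup>\<close>, the power flow equations eliminate \<open>k\<^sub>n\<close> from the diagonal of the Hessian
  of \<open>E\<close>, which becomes \<open>(W G W - diag p)/2\<close> with \<open>W = diag w\<close>. The Rayleigh bound for \<open>G\<close> at \<open>W x\<close>
  and \<open>w\<^sub>n\<^sup>2 \<ge> u\<close> give \<open>x\<^sup>T W G W x \<ge> \<lambda> u |x|\<^sup>2 \<ge> \<Sum>\<^sub>n p\<^sub>n x\<^sub>n\<^sup>2\<close>, where \<open>\<lambda>\<close> is the least eigenvalue of \<open>G\<close>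
  and \<open>u\<close> the lower bound of the box.\<close>

lemma inner_symmetric_matrix:
  fixes A :: "real^'n^'n"
  assumes "transpose A = A"
  shows "x \<bullet> (A *v y) = (A *v x) \<bullet> y"
  using dot_lmul_matrix[of x A y] transpose_matrix_vector[of A x] assms by simp

text \<open>Eigenvectors of distinct eigenvalues are orthogonal, hence independent, and finite
  dimension bounds their number. Finiteness is what gives \<open>Min\<close> in
  \<open>min_eigenvalue\<close> its usual meaning.\<close>

lemma finite_eigenvalues:
  fixes A :: "real^'n^'n"
  assumes "transpose A = A"
  shows "finite {\<mu>. eigenvalue A \<mu>}"
proof -
  define v where "v \<mu> = (SOME x. x \<noteq> 0 \<and> A *v x = \<mu> *\<^sub>R x)" for \<mu>
  have v: "v \<mu> \<noteq> 0 \<and> A *v v \<mu> = \<mu> *\<^sub>R v \<mu>" if "eigenvalue A \<mu>" for \<mu>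
    using that unfolding v_def eigenvalue_def by (rule someI_ex)
  have orth: "v \<mu> \<bullet> v \<nu> = 0" if "eigenvalue A \<mu>" "eigenvalue A \<nu>" "\<mu> \<noteq> \<nu>" for \<mu> \<nu>
    using inner_symmetric_matrix[OF assms, of "v \<mu>" "v \<nu>"] v that by simp
  \<comment> \<open>Independence only bounds the image of \<open>v\<close>. A vector shared by two
    eigenvalues would be orthogonal to itself, hence zero.\<close>
  have inj: "inj_on v {\<mu>. eigenvalue A \<mu>}"
    by (rule inj_onI) (metis inner_eq_zero_iff mem_Collect_eq orth v)
  have "independent (v ` {\<mu>. eigenvalue A \<mu>})"
    by (rule pairwise_orthogonal_independent)
      (use orth v in \<open>force simp: pairwise_def orthogonal_def\<close>)+
  then show ?thesis
    using inj finite_imageD independent_imp_finite by blast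
qed

text \<open>A zero of a nonnegative form is a minimum, so the first-order term vanishes there; it is
  tested along the direction \<open>z = B *v x\<close>.\<close>

lemma null_vector_of_nonneg_form:
  fixes B :: "real^'n^'n"
  assumes sym: "transpose B = B"
    and nonneg: "\<And>x. 0 \<le> x \<bullet> (B *v x)"
    and null: "x \<bullet> (B *v x) = 0"
  shows "B *v x = 0"
proof -
  define z where "z = B *v x"
  define q where "q = z \<bullet> (B *v z)"
  have xz: "x \<bullet> (B *v z) = z \<bullet> z"
    using inner_symmetric_matrix[OF sym, of x z] by (simp add: z_def)
  have pos: "0 \<le> 2 * t * (z \<bullet> z) + t\<^sup>2 * q" for t
  proof -
    have "(x + t *\<^sub>R z) \<bullet> (B *v (x + t *\<^sub>R z)) = 2 * t * (z \<bullet> z) + t\<^sup>2 * q"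
      using xz null
      by (simp add: matrix_vector_right_distrib matrix_vector_mult_scaleR inner_add_left
          inner_add_right q_def z_def[symmetric] power2_eq_square algebra_simps)
    then show ?thesis using nonneg by metis
  qed
  have "z \<bullet> z = 0"
  proof (cases "q = 0")
    case True
    then show ?thesis using pos[of "-1"] inner_ge_zero[of z] by simp
  next
    case False
    then have "q > 0" using nonneg[of z] by (simp add: q_def)
    \<comment> \<open>This \<open>t\<close> minimises the quadratic in \<open>pos\<close>, whose
      least value is minus the fraction below.\<close>
    with pos[of "- (z \<bullet> z) / q"] have "(z \<bullet> z)\<^sup>2 / q \<le> 0"
      by (simp add: power2_eq_square field_simps)
    with \<open>q > 0\<close> show ?thesis
      by (simp add: divide_le_0_iff)
  qed
  then show ?thesis by (simp add: z_def)
qed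

text \<open>By compactness the form attains a minimum on the unit sphere. The minimiser is an
  eigenvector, so the minimum is an eigenvalue and bounds \<open>min_eigenvalue A\<close> from
  above.\<close>

lemma min_eigenvalue_le_quadratic_form:
  fixes A :: "real^'n^'n"
  assumes sym: "transpose A = A"
  shows "min_eigenvalue A * (y \<bullet> y) \<le> y \<bullet> (A *v y)"
proof -
  have "compact (sphere (0::real^'n) 1)" "sphere (0::real^'n) 1 \<noteq> {}"
    by auto
  moreover have "continuous_on (sphere 0 1) (\<lambda>x. x \<bullet> (A *v x))"
    by (intro continuous_intros matrix_vector_mult_linear_continuous_on)
  ultimately obtain x where x: "norm x = 1"
    and min: "\<And>y. norm y = 1 \<Longrightarrow> x \<bullet> (A *v x) \<le> y \<bullet> (A *v y)"
    using continuous_attains_inf by (metis dist_0_norm mem_sphere)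
  define \<mu> where "\<mu> = x \<bullet> (A *v x)"
  have low: "\<mu> * (y \<bullet> y) \<le> y \<bullet> (A *v y)" for y
  proof (cases "y = 0")
    case False
    have "\<mu> \<le> sgn y \<bullet> (A *v sgn y)"
      using min[of "sgn y"] False by (simp add: norm_sgn \<mu>_def)
    also have "\<dots> = (y \<bullet> (A *v y)) / (y \<bullet> y)"
      by (simp add: sgn_div_norm matrix_vector_mult_scaleR dot_square_norm power2_eq_square
          divide_inverse mult.commute mult.left_commute)
    finally show ?thesis using False by (simp add: pos_le_divide_eq)
  qed auto
  \<comment> \<open>By \<open>low\<close>, the form of this shifted matrix is nonnegative, and it
    vanishes at \<open>x\<close>; thus \<open>B *v x = 0\<close>, which is the eigenvalue
    equation.\<close>
  define B where "B = A - mat \<mu>"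
  have B: "B *v y = A *v y - \<mu> *\<^sub>R y" for y
  proof -
    have "mat \<mu> *v y = \<mu> *\<^sub>R y"
      by (simp add: vec_eq_iff matrix_vector_mult_def mat_def if_distrib[of "\<lambda>a. a * _"]
          sum.delta' cong: if_cong)
    then show ?thesis by (simp add: B_def matrix_vector_mult_diff_rdistrib)
  qed
  have "B *v x = 0"
  proof (rule null_vector_of_nonneg_form)
    show "transpose B = B"
      using sym by (simp add: B_def vec_eq_iff transpose_def mat_def)
    show "0 \<le> y \<bullet> (B *v y)" for y
      using low[of y] by (simp add: B inner_diff_right)
    show "x \<bullet> (B *v x) = 0"
      using x by (simp add: B inner_diff_right \<mu>_def dot_square_norm)
  qed
  then have "eigenvalue A \<mu>"
    using x unfolding eigenvalue_def B by (intro exI[of _ x]) auto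
  then have "min_eigenvalue A \<le> \<mu>"
    unfolding min_eigenvalue_def using finite_eigenvalues[OF sym] by (intro Min_le) auto
  then have "min_eigenvalue A * (y \<bullet> y) \<le> \<mu> * (y \<bullet> y)"
    by (intro mult_right_mono) auto
  then show ?thesis using low[of y] by linarith
qed

text \<open>The entries are the left-hand sides of the power flow equations: solutions are the
  stationary points of the energy when the conductances are symmetric.\<close>

definition energy_gradient :: "dc_network \<Rightarrow> ('p::finite \<Rightarrow> nat) \<Rightarrow> real^'p \<Rightarrow> real^'p" where
  "energy_gradient D bus \<rho> =
     (\<chi> n. c_coeff D (bus n) * exp (\<rho> $ n)
          - (\<Sum>m\<in>UNIV. conductance D (bus n) (bus m) * exp ((\<rho> $ n + \<rho> $ m) / 2))
          - k_coeff D (bus n) * exp (\<rho> $ n / 2) + load_power D (bus n))"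

text \<open>On the diagonal, the summand \<open>l = n\<close> and the last term each give half of
  the self term, as \<open>\<rho> $ n\<close> occurs twice in its exponent.\<close>

definition energy_hessian :: "dc_network \<Rightarrow> ('p::finite \<Rightarrow> nat) \<Rightarrow> real^'p \<Rightarrow> real^'p^'p" where
  "energy_hessian D bus \<rho> =
     (\<chi> n m. (if n = m then c_coeff D (bus n) * exp (\<rho> $ n) - k_coeff D (bus n) * exp (\<rho> $ n / 2) / 2
            - (\<Sum>l\<in>UNIV. conductance D (bus n) (bus l) * exp ((\<rho> $ n + \<rho> $ l) / 2)) / 2 else 0)
          - conductance D (bus n) (bus m) * exp ((\<rho> $ n + \<rho> $ m) / 2) / 2)"

lemma has_derivative_nth [derivative_intros]:
  "((\<lambda>x :: real^'p. x $ n) has_derivative (\<lambda>h. h $ n)) F"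
  by (rule bounded_linear_imp_has_derivative) (rule bounded_linear_vec_nth)

lemma energy_gderiv:
  fixes bus :: "'p::finite \<Rightarrow> nat"
  assumes sym: "\<And>n m. conductance D (bus n) (bus m) = conductance D (bus m) (bus n)"
  shows "GDERIV (energy D bus) \<rho> :> energy_gradient D bus \<rho>"
proof -
  define a where "a n m = conductance D (bus n) (bus m) * exp ((\<rho> $ n + \<rho> $ m) / 2)" for n m
  have a: "a n m = a m n" for n m
    by (simp add: a_def sym[of n m] add.commute)
  \<comment> \<open>By symmetry the \<open>h $ n\<close> and \<open>h $ m\<close> parts have equal
    sums, which cancels the factor 1/2 from the exponent.\<close>
  have *: "(\<Sum>n\<in>UNIV. \<Sum>m\<in>UNIV. a n m * ((h $ n + h $ m) / 2)) = (\<Sum>n\<in>UNIV. h $ n * (\<Sum>m\<in>UNIV. a n m))"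
    for h :: "real^'p"
  proof -
    have "(\<Sum>n\<in>UNIV. \<Sum>m\<in>UNIV. a n m * h $ m) = (\<Sum>n\<in>UNIV. \<Sum>m\<in>UNIV. a n m * h $ n)" (is "?M = ?N")
      by (subst sum.swap) (simp add: a)
    moreover have "(\<Sum>n\<in>UNIV. \<Sum>m\<in>UNIV. a n m * ((h $ n + h $ m) / 2)) = (?N + ?M) / 2"
      by (simp add: distrib_left sum.distrib[symmetric] sum_divide_distrib)
    moreover have "?N = (\<Sum>n\<in>UNIV. h $ n * (\<Sum>m\<in>UNIV. a n m))"
      by (simp add: sum_distrib_left mult.commute)
    ultimately show ?thesis
      by (simp only: add_divide_distrib field_sum_of_halves)
  qed
  have "(energy D bus has_derivative
     (\<lambda>h. (\<Sum>n\<in>UNIV. c_coeff D (bus n) * (exp (\<rho> $ n) * h $ n)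
        - 2 * k_coeff D (bus n) * (exp (\<rho> $ n / 2) * (h $ n / 2)) + load_power D (bus n) * h $ n)
      - (\<Sum>n\<in>UNIV. \<Sum>m\<in>UNIV. a n m * ((h $ n + h $ m) / 2)))) (at \<rho>)"
    unfolding energy_def[abs_def] a_def
    by (auto intro!: derivative_eq_intros ext sum.cong arg_cong2[where f = "(-)"])
  from this[unfolded *] show ?thesis
    unfolding gderiv_def
    by (rule has_derivative_eq_rhs)
      (simp add: fun_eq_iff inner_vec_def energy_gradient_def a_def[symmetric] algebra_simps
        sum.distrib sum_subtractf)
qed

lemma energy_gradient_has_derivative:
  fixes bus :: "'p::finite \<Rightarrow> nat"
  shows "(energy_gradient D bus has_derivative (\<lambda>h. energy_hessian D bus \<rho> *v h)) (at \<rho>)"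
proof -
  have "((\<lambda>x. energy_gradient D bus x $ n) has_derivative (\<lambda>h. (energy_hessian D bus \<rho> *v h) $ n)) (at \<rho>)"
    for n
  proof -
    define a where "a m = conductance D (bus n) (bus m) * exp ((\<rho> $ n + \<rho> $ m) / 2)" for m
    have "((\<lambda>x. energy_gradient D bus x $ n) has_derivative
      (\<lambda>h. c_coeff D (bus n) * (exp (\<rho> $ n) * h $ n)
          - (\<Sum>m\<in>UNIV. a m * ((h $ n + h $ m) / 2))
          - k_coeff D (bus n) * (exp (\<rho> $ n / 2) * (h $ n / 2)))) (at \<rho>)"
      unfolding energy_gradient_def a_def vec_lambda_beta
      by (auto intro!: derivative_eq_intros ext sum.cong arg_cong2[where f = "(-)"])
    then show ?thesis
      by (rule has_derivative_eq_rhs)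
        (simp add: fun_eq_iff matrix_vector_mult_def energy_hessian_def a_def
          left_diff_distrib if_distrib[of "\<lambda>a. a * _"] sum_subtractf sum.distrib distrib_left
          add_divide_distrib sum_divide_distrib[symmetric] sum_distrib_right[symmetric]
          cong: if_cong)
  qed
  then show ?thesis
    by (subst has_derivative_componentwise_within)
      (auto simp: Basis_vec_def inner_axis)
qed

theorem lemma5:
  fixes D :: dc_network
    and bus :: "'p::finite \<Rightarrow> nat"
    and u_lo u_hi :: real
  assumes "valid_dc_network D"
    and "enumerates_power_buses D bus"
    and "0 < u_lo" and "u_lo < u_hi"
    and "\<forall>n\<in>power_buses D. max (load_power D n) 0 \<le> min_eigenvalue (G_matrix D bus) * u_lo"
  shows "\<forall>\<rho> :: real^'p. power_flow_solution D bus \<rho> \<and> squared_voltages \<rho> \<in> voltage_box u_lo u_hi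
           \<longrightarrow> convex_at (energy D bus) \<rho>"
proof (intro allI impI, elim conjE)
  fix \<rho> :: "real^'p"
  assume pf: "power_flow_solution D bus \<rho>"
    and box: "squared_voltages \<rho> \<in> voltage_box u_lo u_hi"
  define g where "g n m = conductance D (bus n) (bus m)" for n m
  define w where "w n = exp (\<rho> $ n / 2)" for n
  define p where "p n = load_power D (bus n)" for n
  define G where "G = G_matrix D bus"
  define H where "H = energy_hessian D bus \<rho>"
  define l where "l = min_eigenvalue G"
  have bus: "bus n \<in> power_buses D" "bus n \<in> buses D" for n
    using assms(2) by (auto simp: enumerates_power_buses_def bij_betw_def power_buses_def)
  have g_sym: "g n m = g m n" and g_diag: "g n n = 0" for n m
    using assms(1) bus by (auto simp: valid_dc_network_def g_def)
  have G_sym: "transpose G = G"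
    using g_sym by (auto simp: G_def transpose_def G_matrix_def vec_eq_iff g_def)
  \<comment> \<open>The two arguments of \<open>max\<close> give one bound each. The second makes
    \<open>l\<close> nonnegative, so that \<open>w2_ge\<close> can later be multiplied by
    \<open>l\<close>.\<close>
  have p_le: "p n \<le> l * u_lo" and "0 \<le> l * u_lo" for n
    using assms(5) bus by (force simp: p_def l_def G_def)+
  then have "0 \<le> l"
    using assms(3) by (simp add: zero_le_mult_iff)
  have w2: "w n * w n = exp (\<rho> $ n)" and ww: "exp ((\<rho> $ n + \<rho> $ m) / 2) = w n * w m" for n m
    by (simp_all add: w_def exp_add[symmetric] add_divide_distrib)
  have w2_ge: "u_lo \<le> w n * w n" for n
    using box by (simp add: w2 voltage_box_def squared_voltages_def less_eq_vec_def)
  \<comment> \<open>For \<open>n = m\<close>, the power flow equation replaces the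
    \<open>k_coeff\<close> term and the sum over \<open>l\<close> together by \<open>c_coeff\<close>
    and \<open>p n\<close>; \<open>g_diag\<close> removes the self term.\<close>
  have H_entry: "2 * H $ n $ m = w n * G $ n $ m * w m - (if n = m then p n else 0)" for n m
    using pf[unfolded power_flow_solution_def, rule_format, of n] g_diag[of n]
    by (cases "n = m") (auto simp: H_def energy_hessian_def G_def G_matrix_def ww w2[symmetric]
        w_def[symmetric] g_def[symmetric] p_def[symmetric] algebra_simps)
  have "transpose H = H"
  proof -
    have "2 * H $ n $ m = 2 * H $ m $ n" for n m
      using G_sym unfolding H_entry by (auto simp: transpose_def vec_eq_iff)
    then show ?thesis by (simp add: transpose_def vec_eq_iff)
  qed
  moreover have "0 \<le> x \<bullet> (H *v x)" for x
  proof -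
    \<comment> \<open>Absorbing the weights into the vector leaves the form of \<open>G\<close>
      itself.\<close>
    define y where "y = (\<chi> n. w n * x $ n)"
    have "2 * (x \<bullet> (H *v x)) = (\<Sum>n\<in>UNIV. \<Sum>m\<in>UNIV. x $ n * (2 * H $ n $ m) * x $ m)"
      by (simp add: inner_vec_def matrix_vector_mult_def sum_distrib_left algebra_simps)
    also have "\<dots> = (\<Sum>n\<in>UNIV. \<Sum>m\<in>UNIV. y $ n * (G $ n $ m * y $ m)
        - (if n = m then p n * (x $ n * x $ n) else 0))"
      by (intro sum.cong refl) (simp add: H_entry y_def algebra_simps)
    also have "\<dots> = y \<bullet> (G *v y) - (\<Sum>n\<in>UNIV. p n * (x $ n * x $ n))"
      by (simp add: sum_subtractf inner_vec_def matrix_vector_mult_def sum_distrib_left)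
    also have "\<dots> \<ge> l * (y \<bullet> y) - (\<Sum>n\<in>UNIV. p n * (x $ n * x $ n))"
      using min_eigenvalue_le_quadratic_form[OF G_sym, of y] by (simp add: l_def)
    also have "l * (y \<bullet> y) - (\<Sum>n\<in>UNIV. p n * (x $ n * x $ n))
        = (\<Sum>n\<in>UNIV. (l * (w n * w n) - p n) * (x $ n * x $ n))"
      by (simp add: inner_vec_def y_def sum_distrib_left sum_subtractf algebra_simps)
    also have "\<dots> \<ge> 0"
    proof (rule sum_nonneg, rule mult_nonneg_nonneg)
      fix n
      show "0 \<le> l * (w n * w n) - p n"
        using p_le[of n] mult_left_mono[OF w2_ge[of n] \<open>0 \<le> l\<close>] by linarith
    qed auto
    finally show ?thesis by simp
  qed
  moreover have "has_hessian (energy D bus) H \<rho>"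
    unfolding has_hessian_def H_def
    using energy_gderiv[of D bus] g_sym energy_gradient_has_derivative
    by (intro exI[of _ "energy_gradient D bus"]) (auto simp: g_def)
  ultimately show "convex_at (energy D bus) \<rho>"
    unfolding convex_at_def positive_semidefinite_def by blast
qed

end
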